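(* Let $E,F\in\mathbb{C}^{n\times n}$ with $E^{\mathsf H}=E$ and $F^{\mathsf T}=F$, let $$M=\begin{bmatrix}E&0\\ F&I_n\end{bmatrix},\qquad L=\begin{bmatrix}I_n&\overline{F}\\ 0&\overline{E}\end{bmatrix},$$ and assume that $1\notin\sigma(F)$. Then there exists $[M_*,L_*]\in\mathcal{N}(M,L)$ such that the pair $(\widetilde M,\widetilde L)=(M_*M,\,L_*L)$ is a symplectic pair in SSF-1. Furthermore, it retains the form $$\widetilde M=\begin{bmatrix}\widetilde E&0\\ \widetilde F&I_n\end{bmatrix},\qquad \widetilde L=\begin{bmatrix}I_n&\overline{\widetilde F}\\ 0&\overline{\widetilde E}\end{bmatrix},$$ with $\widetilde E,\widetilde F\in\mathbb{C}^{n\times n}$, $\widetilde E^{\mathsf H}=\widetilde E$ and $\widetilde F^{\mathsf T}=\widetilde F$.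
   Context: $(\cdot)^{\mathsf H}$, $(\cdot)^{\mathsf T}$ and $\overline{(\cdot)}$ denote conjugate transpose, transpose and entrywise complex conjugate; $\sigma(F)$ is the set of singular values of $F$. Let $J=\begin{bmatrix}0&I_n\\ -I_n&0\end{bmatrix}$. A pair $(M,L)$ with $M,L\in\mathbb{C}^{2n\times2n}$ is a symplectic pair if $MJM^{\mathsf T}=LJL^{\mathsf T}$. It is in the first standard symplectic form (SSF-1) if $M=\begin{bmatrix}E&0\\ F&I_n\end{bmatrix}$ and $L=\begin{bmatrix}I_n&K\\ 0&E^{\mathsf T}\end{bmatrix}$ with $E,F,K\in\mathbb{C}^{n\times n}$, $F=F^{\mathsf T}$, $K=K^{\mathsf T}$. For $M,L\in\mathbb{C}^{2n\times 2n}$, $\mathcal{N}(M,L)$ is the set of all $[M_*,L_*]$ with $M_*,L_*\in\mathbb{C}^{2n\times2n}$, $\operatorname{rank}([M_*,L_*])=2n$ and $[M_*,L_*]\begin{bmatrix}L\\ -M\end{bmatrix}=0$ (i.e. $M_*L=L_*M$). The action $(M,L)\mapsto(M_*M,L_*L)$ for $[M_*,L_*]\in\mathcal N(M,L)$ is called a doubling transformation of $(M,L)$. *)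

theory Defs
  imports
    Complex_Main
    "Jordan_Normal_Form.Schur_Decomposition"
    "Jordan_Normal_Form.DL_Rank"
begin

abbreviation conj_mat :: "complex mat \<Rightarrow> complex mat" where
  "conj_mat A \<equiv> map_mat cnj A"

text \<open>The block row \<open>[A, B]\<close>, the column-wise counterpart of \<^const>\<open>append_rows\<close>.\<close>

definition append_cols :: "'a :: zero mat \<Rightarrow> 'a mat \<Rightarrow> 'a mat" (infixr \<open>@\<^sub>c\<close> 65) where
  "A @\<^sub>c B = four_block_mat A B (0\<^sub>m 0 (dim_col A)) (0\<^sub>m 0 (dim_col B))"

text \<open>The square roots of the eigenvalues of \<open>F\<^sup>H F\<close>.\<close>

definition singular_values :: "complex mat \<Rightarrow> real set" where
  "singular_values F =
     {s. 0 \<le> s \<and> eigenvalue (mat_adjoint F * F) (complex_of_real (s ^ 2))}"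

definition symplectic_J :: "nat \<Rightarrow> complex mat" where
  "symplectic_J n = four_block_mat (0\<^sub>m n n) (1\<^sub>m n) (- 1\<^sub>m n) (0\<^sub>m n n)"

definition symplectic_pair :: "nat \<Rightarrow> complex mat \<Rightarrow> complex mat \<Rightarrow> bool" where
  "symplectic_pair n M L \<longleftrightarrow>
     M \<in> carrier_mat (2 * n) (2 * n) \<and> L \<in> carrier_mat (2 * n) (2 * n) \<and>
     M * symplectic_J n * M\<^sup>T = L * symplectic_J n * L\<^sup>T"

definition in_SSF1 :: "nat \<Rightarrow> complex mat \<Rightarrow> complex mat \<Rightarrow> bool" where
  "in_SSF1 n M L \<longleftrightarrow>
     (\<exists>E F K. E \<in> carrier_mat n n \<and> F \<in> carrier_mat n n \<and> K \<in> carrier_mat n n \<and>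
        F\<^sup>T = F \<and> K\<^sup>T = K \<and>
        M = four_block_mat E (0\<^sub>m n n) F (1\<^sub>m n) \<and>
        L = four_block_mat (1\<^sub>m n) K (0\<^sub>m n n) (E\<^sup>T))"

text \<open>
  An element \<open>[M\<^sub>*, L\<^sub>*]\<close> of \<open>\<N>(M, L)\<close> is represented by the pair of its two square blocks.
  The parameter of \<^const>\<open>vec_space.rank\<close> is the number of rows.
\<close>

definition doubling_set ::
  "nat \<Rightarrow> complex mat \<Rightarrow> complex mat \<Rightarrow> (complex mat \<times> complex mat) set" where
  "doubling_set n M L =
     {(Ms, Ls). Ms \<in> carrier_mat (2 * n) (2 * n) \<and> Ls \<in> carrier_mat (2 * n) (2 * n) \<and>
        vec_space.rank (2 * n) (Ms @\<^sub>c Ls) = 2 * n \<and>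
        (Ms @\<^sub>c Ls) * (L @\<^sub>r (- M)) = 0\<^sub>m (2 * n) (2 * n)}"

end

theory Submission
  imports Defs
begin

text \<open>
  Write \<open>X'\<close> for the entrywise conjugate of \<open>X\<close>. Since \<open>F\<close> is symmetric, \<open>F\<^sup>H F = F' F\<close>, so
  \<open>1\<close> not being a singular value of \<open>F\<close> makes \<open>1 - F' F\<close> invertible; let \<open>W\<close> be its inverse. Look
  for \<open>M\<^sub>*\<close> and \<open>L\<^sub>*\<close> with the block patterns of an SSF-1 pair. Then the equation \<open>M\<^sub>* L = L\<^sub>* M\<close> is
  linear in the four free blocks, and solving it gives
  \<open>M\<^sub>* = [E W, 0; E' W' F, 1]\<close> and \<open>L\<^sub>* = [1, E W F'; 0, E' W']\<close>. That these satisfy it comes down to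
  \<open>W = 1 + W F' F\<close> and its conjugate (\<open>resolvent_identity\<close>). The identity blocks force the rank of
  \<open>[M\<^sub>*, L\<^sub>*]\<close> to be full (\<open>rank_append_cols_SSF1\<close>).

  Multiplying out, the new blocks are \<open>E W E\<close> and \<open>F + E' W' F E\<close> on the left, and on the right
  visibly their conjugates. It remains to see that the symmetries survive. Transposing \<open>1 - F' F\<close>
  gives its conjugate, so \<open>W\<^sup>T = W'\<close>, i.e. \<open>W\<close> is Hermitian, and so is \<open>E W E\<close>. The identity
  \<open>F W = W' F\<close> (\<open>push_through\<close>) says that \<open>W' F\<close> is symmetric, hence \<open>E' W' F E\<close> is symmetric, because
  \<open>E\<^sup>T = E'\<close>. Finally, every pair in SSF-1 is a symplectic pair (\<open>in_SSF1_imp_symplectic_pair\<close>).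
\<close>

section \<open>Square blocks and entrywise conjugation\<close>

lemma square_mat_arith:
  fixes A :: "'a :: ring_1 mat"
  assumes "A \<in> carrier_mat n n"
  shows "A * 0\<^sub>m n n = 0\<^sub>m n n" "0\<^sub>m n n * A = 0\<^sub>m n n" "A * 1\<^sub>m n = A" "1\<^sub>m n * A = A"
    "A + 0\<^sub>m n n = A" "0\<^sub>m n n + A = A" "A - A = 0\<^sub>m n n" "A - 0\<^sub>m n n = A"
  using assms by (auto intro: minus_r_inv_mat)

lemma mult_four_block_square_mat:
  fixes A B C D :: "'a :: semiring_0 mat"
  assumes "A \<in> carrier_mat n n" "B \<in> carrier_mat n n" "C \<in> carrier_mat n n" "D \<in> carrier_mat n n"
    "P \<in> carrier_mat n n" "Q \<in> carrier_mat n n" "R \<in> carrier_mat n n" "S \<in> carrier_mat n n"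
  shows "four_block_mat A B C D * four_block_mat P Q R S =
    four_block_mat (A * P + B * R) (A * Q + B * S) (C * P + D * R) (C * Q + D * S)"
  using assms by (rule mult_four_block_mat)

lemma conj_mat_mult:
  assumes "A \<in> carrier_mat m k" "B \<in> carrier_mat k l"
  shows "conj_mat (A * B) = conj_mat A * conj_mat B"
  using assms by (intro eq_matI) (auto simp: scalar_prod_def)

lemma conj_mat_add:
  assumes "A \<in> carrier_mat m k" "B \<in> carrier_mat m k"
  shows "conj_mat (A + B) = conj_mat A + conj_mat B"
  using assms by (intro eq_matI) auto

lemma conj_mat_one: "conj_mat (1\<^sub>m n) = 1\<^sub>m n"
  by (intro eq_matI) auto

lemma conj_mat_conj_mat: "conj_mat (conj_mat A) = A"
  by (intro eq_matI) auto

lemma mat_adjoint_eq_conj_transpose: "mat_adjoint A = conj_mat A\<^sup>T"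
  by (intro eq_matI) (auto simp: mat_adjoint_def mat_of_rows_def)

section \<open>Block rows and their rank\<close>

lemma append_cols_mult_append_rows:
  fixes A B C D :: "'a :: comm_ring_1 mat"
  assumes "A \<in> carrier_mat m k" "B \<in> carrier_mat m l" "C \<in> carrier_mat k p" "D \<in> carrier_mat l p"
  shows "(A @\<^sub>c B) * (C @\<^sub>r D) = A * C + B * D"
proof -
  have "(A @\<^sub>c B) * (C @\<^sub>r D) =
      four_block_mat (A * C + B * D) (A * 0\<^sub>m k 0 + B * 0\<^sub>m l 0)
        (0\<^sub>m 0 k * C + 0\<^sub>m 0 l * D) (0\<^sub>m 0 k * 0\<^sub>m k 0 + 0\<^sub>m 0 l * 0\<^sub>m l 0)"
    using assms unfolding append_cols_def append_rows_def
    by (simp add: mult_four_block_mat[of _ m k _ l _ 0 _ _ p _ 0])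
  also have "\<dots> = A * C + B * D"
    using assms by (intro eq_matI) auto
  finally show ?thesis .
qed

lemma rank_eq_if_unit_vecs_in_cols:
  fixes A :: "'a :: field mat"
  assumes A: "A \<in> carrier_mat m k" and units: "set (unit_vecs m) \<subseteq> set (cols A)"
  shows "vec_space.rank m A = m"
proof -
  interpret vec_space "TYPE('a)" m .
  have cols: "set (cols A) \<subseteq> carrier_vec m"
    using A cols_dim by blast
  have "span (set (cols A)) = carrier_vec m"
  proof (rule antisym)
    show "span (set (cols A)) \<subseteq> carrier_vec m"
      using span_is_subset2[OF cols] by simp
    show "carrier_vec m \<subseteq> span (set (cols A))"
      using span_is_monotone[OF units] by (simp add: span_unit_vecs_is_carrier)
  qed
  then show ?thesis
    unfolding rank_def using dim_is_n by (simp add: module_vec_def)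
qed

text \<open>
  The last \<open>n\<close> columns of the left block and the first \<open>n\<close> columns of the right block together
  form the standard basis.
\<close>

lemma rank_append_cols_SSF1:
  fixes A B C D :: "'a :: field mat"
  assumes [simp]: "A \<in> carrier_mat n n" "B \<in> carrier_mat n n" "C \<in> carrier_mat n n" "D \<in> carrier_mat n n"
  shows "vec_space.rank (2 * n)
    (four_block_mat A (0\<^sub>m n n) B (1\<^sub>m n) @\<^sub>c four_block_mat (1\<^sub>m n) C (0\<^sub>m n n) D) = 2 * n"
    (is "vec_space.rank _ ?R = _")
proof (rule rank_eq_if_unit_vecs_in_cols)
  have dims [simp]: "dim_row A = n" "dim_col A = n" "dim_row B = n" "dim_col B = n"
      "dim_row C = n" "dim_col C = n" "dim_row D = n" "dim_col D = n"
    using assms[THEN carrier_matD(1)] assms[THEN carrier_matD(2)] by auto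
  show R: "?R \<in> carrier_mat (2 * n) (4 * n)"
    unfolding append_cols_def by (auto intro!: carrier_matI)
  show "set (unit_vecs (2 * n)) \<subseteq> set (cols ?R)"
  proof
    fix v :: "'a vec"
    assume "v \<in> set (unit_vecs (2 * n))"
    then obtain i where i: "i < 2 * n" and v: "v = unit_vec (2 * n) i"
      unfolding unit_vecs_def by auto
    (* The right block starts at column 2 * n, and its first n columns are the first n unit vectors. *)
    define j where "j = (if i < n then 2 * n + i else i)"
    have j: "j < 4 * n" using i by (auto simp: j_def)
    have "col ?R j = v"
      unfolding v using i j by (intro eq_vecI) (auto simp: append_cols_def j_def unit_vec_def)
    moreover have "col ?R j \<in> set (cols ?R)"
      using R j by (auto simp: cols_def)
    ultimately show "v \<in> set (cols ?R)" by simp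
  qed
qed

section \<open>Symplectic pairs\<close>

lemma four_block_symplectic_J_quadratic:
  fixes A B C D :: "complex mat"
  assumes [simp]: "A \<in> carrier_mat n n" "B \<in> carrier_mat n n" "C \<in> carrier_mat n n" "D \<in> carrier_mat n n"
  shows "four_block_mat A B C D * symplectic_J n * (four_block_mat A B C D)\<^sup>T =
    four_block_mat (A * B\<^sup>T - B * A\<^sup>T) (A * D\<^sup>T - B * C\<^sup>T) (C * B\<^sup>T - D * A\<^sup>T) (C * D\<^sup>T - D * C\<^sup>T)"
proof -
  have neg: "- Y * X = - (Y * X)" if "X \<in> carrier_mat n n" "Y \<in> carrier_mat n n" for X Y :: "complex mat"
    by (rule uminus_mult_left_mat) (use carrier_matD[OF that(1)] carrier_matD[OF that(2)] in simp)
  have times_neg_one: "X * - 1\<^sub>m n = - X" if "X \<in> carrier_mat n n" for X :: "complex mat"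
  proof -
    have "X * - 1\<^sub>m n = - (X * 1\<^sub>m n)"
      by (rule uminus_mult_right_mat) (use carrier_matD[OF that] in simp)
    then show ?thesis using that by simp
  qed
  have 1: "four_block_mat A B C D * symplectic_J n = four_block_mat (- B) A (- D) C"
    unfolding symplectic_J_def
    by (subst mult_four_block_square_mat[where n = n])
      (simp_all add: times_neg_one square_mat_arith[of _ n])
  have 2: "(four_block_mat A B C D)\<^sup>T = four_block_mat A\<^sup>T C\<^sup>T B\<^sup>T D\<^sup>T"
    by (rule transpose_four_block_mat[OF assms])
  have 3: "- X + Y = Y - X" if "X \<in> carrier_mat n n" "Y \<in> carrier_mat n n" for X Y :: "complex mat"
    using that by (intro eq_matI) auto
  show ?thesis
    unfolding 1 2
    by (subst mult_four_block_square_mat[where n = n])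
      (simp_all add: neg 3 mult_carrier_mat[of _ n n _ n])
qed

text \<open>
  Both sides of the defining equation equal \<open>[0, E; - E\<^sup>T, 0]\<close>: the diagonal block that is not
  trivially zero is \<open>F - F\<^sup>T\<close> on the left and \<open>K\<^sup>T - K\<close> on the right.
\<close>

lemma in_SSF1_imp_symplectic_pair:
  assumes "in_SSF1 n M L"
  shows "symplectic_pair n M L"
proof -
  obtain E F K where c [simp]: "E \<in> carrier_mat n n" "F \<in> carrier_mat n n" "K \<in> carrier_mat n n"
    and sym [simp]: "F\<^sup>T = F" "K\<^sup>T = K"
    and M: "M = four_block_mat E (0\<^sub>m n n) F (1\<^sub>m n)"
    and L: "L = four_block_mat (1\<^sub>m n) K (0\<^sub>m n n) (E\<^sup>T)"
    using assms unfolding in_SSF1_def by blast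
  let ?Z = "four_block_mat (0\<^sub>m n n) E (0\<^sub>m n n - E\<^sup>T) (0\<^sub>m n n)"
  have "M \<in> carrier_mat (2 * n) (2 * n)" "L \<in> carrier_mat (2 * n) (2 * n)"
    unfolding M L mult_2 by (auto intro!: four_block_carrier_mat)
  moreover have "M * symplectic_J n * M\<^sup>T = ?Z"
    unfolding M by (subst four_block_symplectic_J_quadratic) (simp_all add: square_mat_arith[of _ n])
  moreover have "L * symplectic_J n * L\<^sup>T = ?Z"
    unfolding L by (subst four_block_symplectic_J_quadratic) (simp_all add: square_mat_arith[of _ n])
  ultimately show ?thesis
    unfolding symplectic_pair_def by simp
qed

section \<open>The inverse of the identity minus a product\<close>

text \<open>
  A null vector of \<open>1 - F\<^sup>H F\<close> would be an eigenvector of \<open>F\<^sup>H F\<close> for the eigenvalue \<open>1 = 1\<^sup>2\<close>.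
\<close>

lemma invertible_if_one_not_singular_value:
  assumes F: "F \<in> carrier_mat n n" and "1 \<notin> singular_values F"
  obtains W where "W \<in> carrier_mat n n"
    "(1\<^sub>m n - mat_adjoint F * F) * W = 1\<^sub>m n" "W * (1\<^sub>m n - mat_adjoint F * F) = 1\<^sub>m n"
proof -
  let ?H = "mat_adjoint F * F"
  let ?R = "ring_mat TYPE(complex) n ()"
  have H: "?H \<in> carrier_mat n n"
    using F by (auto simp: mat_adjoint_eq_conj_transpose)
  have "det (1\<^sub>m n - ?H) \<noteq> 0"
  proof
    assume "det (1\<^sub>m n - ?H) = 0"
    then obtain v where v: "v \<in> carrier_vec n" "v \<noteq> 0\<^sub>v n" and null: "(1\<^sub>m n - ?H) *\<^sub>v v = 0\<^sub>v n"
      using det_0_iff_vec_prod_zero[OF minus_carrier_mat[OF H, where A = "1\<^sub>m n"]] by auto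
    have "v - ?H *\<^sub>v v = 0\<^sub>v n"
      using null minus_mult_distrib_mat_vec[OF one_carrier_mat H v(1)] v by simp
    then have "?H *\<^sub>v v = 1 \<cdot>\<^sub>v v"
      using v(1) H by (intro eq_vecI) (auto simp: vec_eq_iff simp del: index_mult_mat_vec assoc_mult_mat_vec)
    then have "eigenvalue ?H 1"
      using v unfolding eigenvalue_def eigenvector_def carrier_matD(1)[OF H] by auto
    then show False
      using assms(2) by (simp add: singular_values_def)
  qed
  then have "1\<^sub>m n - ?H \<in> Units ?R"
    by (rule det_non_zero_imp_unit[OF minus_carrier_mat[OF H]])
  then show thesis
    using that unfolding Units_def ring_mat_def by auto
qed

text \<open>
  Multiply \<open>(1 - F G) F = F (1 - G F)\<close> by the inverse of \<open>1 - F G\<close> on the left and by that of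
  \<open>1 - G F\<close> on the right. With \<open>G\<close> the conjugate of a symmetric \<open>F\<close>, this is what keeps the
  doubled \<open>F\<close>-block symmetric.
\<close>

lemma push_through:
  fixes F G W V :: "'a :: comm_ring_1 mat"
  assumes c: "F \<in> carrier_mat n m" "G \<in> carrier_mat m n" "W \<in> carrier_mat m m" "V \<in> carrier_mat n n"
    and W: "(1\<^sub>m m - G * F) * W = 1\<^sub>m m" and V: "V * (1\<^sub>m n - F * G) = 1\<^sub>m n"
  shows "F * W = V * F"
proof -
  note [simp] = minus_carrier_mat
  have comm: "(1\<^sub>m n - F * G) * F = F * (1\<^sub>m m - G * F)"
    using c by (simp add: minus_mult_distrib_mat[of _ n n _ _ m] mult_minus_distrib_mat[of _ n m _ m]
      assoc_mult_mat[of F n m G n F m])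
  have "F * W = (V * (1\<^sub>m n - F * G)) * (F * W)"
    using c by (simp add: V)
  also have "\<dots> = V * (((1\<^sub>m n - F * G) * F) * W)"
    using c by (simp add: assoc_mult_mat[of _ n n _ n _ m] assoc_mult_mat[of _ n n _ m _ m])
  also have "\<dots> = V * (F * ((1\<^sub>m m - G * F) * W))"
    unfolding comm using c by (simp add: assoc_mult_mat[of _ n m _ m _ m])
  also have "\<dots> = V * F"
    using c by (simp add: W)
  finally show ?thesis .
qed

lemma resolvent_identity:
  fixes W P :: "'a :: comm_ring_1 mat"
  assumes c: "W \<in> carrier_mat n n" "P \<in> carrier_mat n n" and W: "W * (1\<^sub>m n - P) = 1\<^sub>m n"
  shows "1\<^sub>m n + W * P = W"
proof -
  have "W - W * P = 1\<^sub>m n"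
    using W c by (simp add: mult_minus_distrib_mat[of _ n n _ n])
  then have "1\<^sub>m n + W * P = (W - W * P) + W * P" by simp
  also have "\<dots> = W"
    using c by (intro eq_matI) auto
  finally show ?thesis .
qed

lemma left_right_inverse_unique:
  fixes A X Y :: "'a :: comm_ring_1 mat"
  assumes c: "A \<in> carrier_mat n n" "X \<in> carrier_mat n n" "Y \<in> carrier_mat n n"
    and "X * A = 1\<^sub>m n" "A * Y = 1\<^sub>m n"
  shows "X = Y"
  using assms assoc_mult_mat[OF c(2,1,3)] by simp

section \<open>The doubling transformation\<close>

theorem theorem3p7:
  fixes n :: nat and E F M L :: "complex mat"
  assumes "E \<in> carrier_mat n n" and "F \<in> carrier_mat n n"
    and "mat_adjoint E = E" and "F\<^sup>T = F"
    and "M = four_block_mat E (0\<^sub>m n n) F (1\<^sub>m n)"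
    and "L = four_block_mat (1\<^sub>m n) (conj_mat F) (0\<^sub>m n n) (conj_mat E)"
    and "1 \<notin> singular_values F"
  shows "\<exists>Ms Ls. (Ms, Ls) \<in> doubling_set n M L \<and>
    symplectic_pair n (Ms * M) (Ls * L) \<and> in_SSF1 n (Ms * M) (Ls * L) \<and>
    (\<exists>Et Ft. Et \<in> carrier_mat n n \<and> Ft \<in> carrier_mat n n \<and>
       mat_adjoint Et = Et \<and> Ft\<^sup>T = Ft \<and>
       Ms * M = four_block_mat Et (0\<^sub>m n n) Ft (1\<^sub>m n) \<and>
       Ls * L = four_block_mat (1\<^sub>m n) (conj_mat Ft) (0\<^sub>m n n) (conj_mat Et))"
proof -
  note E [simp] = assms(1) and F [simp] = assms(2)
  note [simp] = minus_carrier_mat[of _ n n] mult_carrier_mat[of _ n n _ n]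
  note assoc = assoc_mult_mat[of _ n n _ n _ n]
  define E' where "E' = conj_mat E"
  define G where "G = conj_mat F"
  have E' [simp]: "E' \<in> carrier_mat n n" and G [simp]: "G \<in> carrier_mat n n"
    by (auto simp: E'_def G_def)
  have cE: "conj_mat E = E'" "conj_mat E' = E" and cF: "conj_mat F = G" "conj_mat G = F"
    by (simp_all add: E'_def G_def conj_mat_conj_mat)
  have tE: "E\<^sup>T = E'"
    using assms(3) conj_mat_conj_mat[of "E\<^sup>T"] by (simp add: mat_adjoint_eq_conj_transpose E'_def)
  then have tE': "E'\<^sup>T = E" by (metis transpose_transpose)
  have tG: "G\<^sup>T = G"
    using assms(4) by (simp add: G_def map_mat_transpose)
  have "mat_adjoint F = G"
    by (simp add: mat_adjoint_eq_conj_transpose assms(4) G_def)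
  then obtain W where Wc [simp]: "W \<in> carrier_mat n n"
    and W1: "(1\<^sub>m n - G * F) * W = 1\<^sub>m n" and W2: "W * (1\<^sub>m n - G * F) = 1\<^sub>m n"
    using invertible_if_one_not_singular_value[OF F assms(7)] by metis
  define V where "V = conj_mat W"
  have V [simp]: "V \<in> carrier_mat n n" by (simp add: V_def)
  have cW: "conj_mat W = V" "conj_mat V = W" by (simp_all add: V_def conj_mat_conj_mat)
  have conj_1GF: "conj_mat (1\<^sub>m n - G * F) = 1\<^sub>m n - F * G"
  proof -
    have "conj_mat (1\<^sub>m n - G * F) = conj_mat (1\<^sub>m n) - conj_mat (G * F)"
      using carrier_matD[OF F] carrier_matD[OF G] by (intro eq_matI) auto
    then show ?thesis by (simp add: conj_mat_one conj_mat_mult[OF G F] cF)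
  qed
  have V1: "(1\<^sub>m n - F * G) * V = 1\<^sub>m n"
    using arg_cong[OF W1, of conj_mat] conj_mat_mult[of "1\<^sub>m n - G * F" n n W n]
    by (simp add: conj_1GF cW conj_mat_one)
  have V2: "V * (1\<^sub>m n - F * G) = 1\<^sub>m n"
    using arg_cong[OF W2, of conj_mat] conj_mat_mult[of W n n "1\<^sub>m n - G * F" n]
    by (simp add: conj_1GF cW conj_mat_one)
  (* W is Hermitian. *)
  have tW: "W\<^sup>T = V"
  proof (rule left_right_inverse_unique)
    have "(1\<^sub>m n - G * F)\<^sup>T = 1\<^sub>m n - F * G"
      using transpose_minus[of "1\<^sub>m n" n n "G * F"] transpose_mult[OF G F] by (simp add: assms(4) tG)
    then show "W\<^sup>T * (1\<^sub>m n - F * G) = 1\<^sub>m n"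
      using arg_cong[OF W1, of transpose_mat] transpose_mult[of "1\<^sub>m n - G * F" n n W n] by simp
  qed (use V1 in auto)
  then have tV: "V\<^sup>T = W" by (metis transpose_transpose)
  have FW: "F * W = V * F"
    by (rule push_through[OF F G Wc V W1 V2])
  have resW: "1\<^sub>m n + W * (G * F) = W" and resV: "1\<^sub>m n + V * (F * G) = V"
    using W2 V2 by (simp_all add: resolvent_identity[of _ n])

  define Ms where "Ms = four_block_mat (E * W) (0\<^sub>m n n) (E' * V * F) (1\<^sub>m n)"
  define Ls where "Ls = four_block_mat (1\<^sub>m n) (E * W * G) (0\<^sub>m n n) (E' * V)"
  define Et where "Et = E * W * E"
  define Ft where "Ft = E' * V * F * E + F"
  have Et [simp]: "Et \<in> carrier_mat n n" and Ft [simp]: "Ft \<in> carrier_mat n n"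
    by (simp_all add: Et_def Ft_def)
  have M: "M = four_block_mat E (0\<^sub>m n n) F (1\<^sub>m n)" and L: "L = four_block_mat (1\<^sub>m n) G (0\<^sub>m n n) E'"
    using assms(5,6) by (simp_all add: G_def E'_def)
  have car: "Ms \<in> carrier_mat (2 * n) (2 * n)" "Ls \<in> carrier_mat (2 * n) (2 * n)"
      "M \<in> carrier_mat (2 * n) (2 * n)" "L \<in> carrier_mat (2 * n) (2 * n)"
    unfolding Ms_def Ls_def M L mult_2 by (auto intro!: four_block_carrier_mat)

  have cEt: "conj_mat Et = E' * V * E'"
    by (simp add: Et_def conj_mat_mult[of _ n n _ n] cE cW)
  have cFt: "conj_mat Ft = E * W * G * E' + G"
    by (simp add: Ft_def conj_mat_add[of _ n n] conj_mat_mult[of _ n n _ n] cE cW cF)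
  have tEt: "Et\<^sup>T = E' * V * E'"
    by (simp add: Et_def transpose_mult[of _ n n _ n] tE tW assoc)
  have "Ft\<^sup>T = E' * (F * W) * E + F"
    by (simp add: Ft_def transpose_add[of _ n n] transpose_mult[of _ n n _ n] tE tE' tV assms(4) assoc)
  then have tFt: "Ft\<^sup>T = Ft"
    by (simp add: FW Ft_def assoc)
  have hEt: "mat_adjoint Et = Et"
    unfolding mat_adjoint_eq_conj_transpose tEt cEt[symmetric] by (rule conj_mat_conj_mat)

  have MsM: "Ms * M = four_block_mat Et (0\<^sub>m n n) Ft (1\<^sub>m n)"
    unfolding Ms_def M by (subst mult_four_block_square_mat[where n = n]) (simp_all add: Et_def Ft_def square_mat_arith[of _ n])
  have "G + E * W * G * E' = E * W * G * E' + G"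
    by (rule comm_add_mat[of _ n n]) simp_all
  then have LsL: "Ls * L = four_block_mat (1\<^sub>m n) (conj_mat Ft) (0\<^sub>m n n) (conj_mat Et)"
    unfolding Ls_def L cEt cFt
    by (subst mult_four_block_square_mat[where n = n]) (simp_all add: square_mat_arith[of _ n])

  (* The two blocks in which Ms * L and Ls * M are not literally equal. *)
  have "E + E * W * G * F = E * (1\<^sub>m n + W * (G * F))"
    by (simp add: mult_add_distrib_mat[of _ n n _ n] assoc square_mat_arith[of _ n])
  then have upper: "E + E * W * G * F = E * W" by (simp add: resW)
  have "E' * V * F * G + E' = E' + E' * V * F * G"
    by (rule comm_add_mat[of _ n n]) simp_all
  also have "\<dots> = E' * (1\<^sub>m n + V * (F * G))"
    by (simp add: mult_add_distrib_mat[of _ n n _ n] assoc square_mat_arith[of _ n])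
  finally have lower: "E' * V * F * G + E' = E' * V" by (simp add: resV)
  have "Ms * L = four_block_mat (E * W) (E * W * G) (E' * V * F) (E' * V)"
    unfolding Ms_def L by (subst mult_four_block_square_mat[where n = n]) (simp_all add: lower square_mat_arith[of _ n])
  moreover have "Ls * M = four_block_mat (E * W) (E * W * G) (E' * V * F) (E' * V)"
    unfolding Ls_def M by (subst mult_four_block_square_mat[where n = n]) (simp_all add: upper square_mat_arith[of _ n])
  ultimately have "Ms * L = Ls * M" by simp
  then have "(Ms @\<^sub>c Ls) * (L @\<^sub>r (- M)) = 0\<^sub>m (2 * n) (2 * n)"
    using car append_cols_mult_append_rows[of Ms "2 * n" "2 * n" Ls "2 * n" L "2 * n" "- M"]
      uminus_mult_right_mat[of Ls M]
      add_uminus_minus_mat[OF mult_carrier_mat mult_carrier_mat, OF car(2,3) car(2,3)]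
      minus_r_inv_mat[OF mult_carrier_mat[OF car(2,3)]]
    by (simp add: carrier_matD[OF car(2)] carrier_matD[OF car(3)])
  moreover have "vec_space.rank (2 * n) (Ms @\<^sub>c Ls) = 2 * n"
    unfolding Ms_def Ls_def by (rule rank_append_cols_SSF1) auto
  ultimately have doubling: "(Ms, Ls) \<in> doubling_set n M L"
    using car by (simp add: doubling_set_def)

  have ssf: "in_SSF1 n (Ms * M) (Ls * L)"
    unfolding in_SSF1_def
  proof (intro exI conjI)
    show "Ms * M = four_block_mat Et (0\<^sub>m n n) Ft (1\<^sub>m n)"
      by (rule MsM)
    show "Ls * L = four_block_mat (1\<^sub>m n) (conj_mat Ft) (0\<^sub>m n n) (Et\<^sup>T)"
      using LsL by (simp add: tEt cEt)
    show "(conj_mat Ft)\<^sup>T = conj_mat Ft"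
      by (simp add: map_mat_transpose tFt)
  qed (simp_all add: tFt)
  show ?thesis
    by (intro exI[of _ Ms] exI[of _ Ls] conjI exI[of _ Et] exI[of _ Ft])
      (rule doubling ssf in_SSF1_imp_symplectic_pair[OF ssf] MsM LsL hEt tFt Et Ft)+
qed

end
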